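(* Let $F[\rho]=\mathrm{KL}[\rho|e^{-U}]$ with $U\in C^\infty(\mathbb{R}^d)$. Assume $U$ is gradient Lipschitz, meaning $\mathrm{Hess}[U]\preceq M I$ for some $M\in(0,+\infty)$. Let $\rho_0=e^{-V_0}$ with $V_0\in C^{m+2}(\mathbb{R}^d)$ and $\mathrm{Hess}[V_0]\succeq -M_0I$ for some $M_0>0$. Then the one-step forward Euler update $$\rho_1=(T_0)_\#\rho_0=e^{-V_1},\qquad T_0(x)=x-h_0\nabla\frac{\delta F}{\delta\rho}\Big|_{\rho_0}(x),$$ necessarily has reduced regularity. Specifically, for $h_0\in\left(0,\frac{1}{M+M_0}\right)$, we have $V_1\in C^m$, i.e. $V_1$ has two fewer derivatives than $V_0$.
   Context: $m\ge 0$ is an integer (order of differentiability) and $h_0$ is the step size. $T_\#\rho$ denotes the pushforward of $\rho$ by $T$, and the same symbol denotes a probability measure on $\mathbb{R}^d$ and its Lebesgue density; $e^{-U}$ and $e^{-V_0}$ are probability densities. $\mathrm{KL}[\rho|\rho^*]=\int \frac{d\rho}{d\rho^*}\ln\left(\frac{d\rho}{d\rho^*}\right)d\rho^*$ if $\rho\ll\rho^*$, and $+\infty$ otherwise. $\frac{\delta F}{\delta\rho}\big|_\rho$ is the first variation of $F$ at $\rho$; for $F=\mathrm{KL}[\cdot|e^{-U}]$ and $\rho=e^{-V}$ it is $1+U-V$, with gradient $\nabla U-\nabla V$, so that $T_0(x)=x-h_0(\nabla U(x)-\nabla V_0(x))$. $\mathrm{Hess}$ denotes the Hessian matrix, $I$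 is the identity matrix, and $\preceq$, $\succeq$ denote the Loewner order. *)

theory Defs
  imports "HOL-Probability.Probability"
begin

text \<open>Frechet differentiability is demanded at every step, so this agrees with the usual definition by
  existence and continuity of all partial derivatives up to order \<open>k\<close>.\<close>

primrec C_k :: "nat \<Rightarrow> ('a::euclidean_space \<Rightarrow> 'b::real_normed_vector) \<Rightarrow> bool" where
  "C_k 0 f \<longleftrightarrow> continuous_on UNIV f"
| "C_k (Suc k) f \<longleftrightarrow> (\<forall>x. f differentiable (at x)) \<and>
     (\<forall>b\<in>Basis. C_k k (\<lambda>x. frechet_derivative f (at x) b))"

definition C_infinity :: "('a::euclidean_space \<Rightarrow> 'b::real_normed_vector) \<Rightarrow> bool" where
  "C_infinity f \<longleftrightarrow> (\<forall>k. C_k k f)"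

definition grad :: "('a::real_inner \<Rightarrow> real) \<Rightarrow> 'a \<Rightarrow> 'a" where
  "grad f x = (THE D. GDERIV f x :> D)"

definition Hess :: "(real^'n \<Rightarrow> real) \<Rightarrow> real^'n \<Rightarrow> real^'n^'n" where
  "Hess f x = jacobian (grad f) (at x)"

definition positive_semidefinite :: "real^'n^'n \<Rightarrow> bool" where
  "positive_semidefinite A \<longleftrightarrow> transpose A = A \<and> (\<forall>v. 0 \<le> v \<bullet> (A *v v))"

definition loewner_le :: "real^'n^'n \<Rightarrow> real^'n^'n \<Rightarrow> bool" where
  "loewner_le A B \<longleftrightarrow> positive_semidefinite (B - A)"

definition dens :: "('a::euclidean_space \<Rightarrow> real) \<Rightarrow> 'a measure" where
  "dens p = density lborel (\<lambda>x. ennreal (p x))"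

text \<open>The negative part of \<open>t * ln t\<close> is bounded, so for finite \<open>\<sigma>\<close> the integral below is
  \<open>+\<infinity>\<close> exactly when the integrand is not integrable. In HOL \<open>0 * ln 0 = 0\<close>.\<close>

definition KL :: "'a measure \<Rightarrow> 'a measure \<Rightarrow> ereal" where
  "KL \<rho> \<sigma> =
     (let f = (\<lambda>x. enn2real (RN_deriv \<sigma> \<rho> x)) in
      if sets \<rho> = sets \<sigma> \<and> absolutely_continuous \<sigma> \<rho> \<and> integrable \<sigma> (\<lambda>x. f x * ln (f x))
      then ereal (\<integral>x. f x * ln (f x) \<partial>\<sigma>) else \<infinity>)"

text \<open>\<open>g\<close> is (the continuous version of) the first variation at the density \<open>p\<close> of a functional \<open>F\<close> that
  is additive over disjoint regions, such as \<open>KL[\<cdot>|\<sigma>]\<close>: the derivative at \<open>\<epsilon> = 0\<close> of \<open>F[p + \<epsilon> \<eta>]\<close> is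
  \<open>\<integral> g \<eta>\<close> for all compactly supported perturbations \<open>\<eta>\<close> of total mass \<open>0\<close>. As usual, \<open>g\<close> is
  determined only up to an additive constant.
  \<open>F\<close> is evaluated on the part of the measure in a ball containing the support of \<open>\<eta>\<close>.
  The part outside does not depend on \<open>\<epsilon>\<close>, so when \<open>F[p]\<close> is finite this is the derivative of
  \<open>F[p + \<epsilon> \<eta>]\<close> itself; the first variation also makes sense when \<open>F[p] = \<infinity>\<close>.
  The definition is meant for positive continuous \<open>p\<close>, where \<open>p + \<epsilon> \<eta>\<close> is positive on the ball for small \<open>\<epsilon>\<close>.\<close>

definition first_variation ::
  "('a::euclidean_space measure \<Rightarrow> ereal) \<Rightarrow> ('a \<Rightarrow> real) \<Rightarrow> ('a \<Rightarrow> real) \<Rightarrow> bool" where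
  "first_variation F p g \<longleftrightarrow> continuous_on UNIV g \<and>
     (\<forall>\<eta> R. continuous_on UNIV \<eta> \<and> (\<forall>x. x \<notin> cball 0 R \<longrightarrow> \<eta> x = 0) \<and> (\<integral>x. \<eta> x \<partial>lborel) = 0 \<longrightarrow>
       (let G = (\<lambda>\<epsilon>. F (dens (\<lambda>x. indicator (cball 0 R) x * (p x + \<epsilon> * \<eta> x)))) in
         (\<forall>\<^sub>F \<epsilon> in nhds 0. \<bar>G \<epsilon>\<bar> \<noteq> \<infinity>) \<and>
         ((\<lambda>\<epsilon>. real_of_ereal (G \<epsilon>)) has_real_derivative (\<integral>x. g x * \<eta> x \<partial>lborel)) (at 0)))"

definition gibbs :: "('a::euclidean_space \<Rightarrow> real) \<Rightarrow> 'a measure" where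
  "gibbs V = dens (\<lambda>x. exp (- V x))"

lemma KL_dens:
  fixes p q :: "'a::euclidean_space \<Rightarrow> real"
  assumes [measurable]: "p \<in> borel_measurable borel" "q \<in> borel_measurable borel"
    and p: "\<And>x. 0 \<le> p x" and q: "\<And>x. 0 < q x" and fin: "prob_space (dens q)"
    and int: "integrable lborel (\<lambda>x. p x * ln (p x / q x))"
  shows "KL (dens p) (dens q) = ereal (\<integral>x. p x * ln (p x / q x) \<partial>lborel)"
proof -
  interpret Q: prob_space "dens q" by (rule fin)
  have setsq[measurable_cong]: "sets (dens q) = sets borel" by (simp add: dens_def)
  have eq: "density (dens q) (\<lambda>x. ennreal (p x / q x)) = dens p"
    unfolding dens_def
    apply (subst density_density_eq)
      apply simp_all
    apply (rule density_cong)
      apply simp_all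
    apply (rule AE_I2)
    subgoal for x using p[of x] q[of x] by (simp add: ennreal_mult[symmetric] less_imp_le)
    done
  have ac: "absolutely_continuous (dens q) (dens p)"
    unfolding eq[symmetric] by (rule absolutely_continuousI_density) simp
  have ae: "AE x in dens q. ennreal (p x / q x) = RN_deriv (dens q) (dens p) x"
    by (rule Q.RN_deriv_unique[OF _ eq]) simp
  define f where "f = (\<lambda>x. enn2real (RN_deriv (dens q) (dens p) x))"
  have fm[measurable]: "f \<in> borel_measurable (dens q)" unfolding f_def by measurable
  have ae2: "AE x in dens q. f x * ln (f x) = p x / q x * ln (p x / q x)"
    using ae
  proof eventually_elim
    case (elim x)
    have "f x = p x / q x" unfolding f_def elim[symmetric] using p[of x] q[of x] by simp
    then show ?case by simp
  qed
  have qe: "q x * (p x / q x * ln (p x / q x)) = p x * ln (p x / q x)" for x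
    using q[of x] by simp
  have i1: "integrable (dens q) (\<lambda>x. p x / q x * ln (p x / q x))"
    unfolding dens_def using int q
    by (subst integrable_real_density) (auto simp: less_imp_le qe[unfolded times_divide_eq_right times_divide_eq_left])
  have i2: "integrable (dens q) (\<lambda>x. f x * ln (f x))"
  proof (rule integrable_cong_AE[OF _ _ ae2, THEN iffD2])
    show "(\<lambda>x. f x * ln (f x)) \<in> borel_measurable (dens q)" by measurable
    show "(\<lambda>x. p x / q x * ln (p x / q x)) \<in> borel_measurable (dens q)" by measurable
  qed (rule i1)
  have "(\<integral>x. f x * ln (f x) \<partial>dens q) = (\<integral>x. p x / q x * ln (p x / q x) \<partial>dens q)"
    by (rule integral_cong_AE[OF _ _ ae2]) measurable
  also have "\<dots> = (\<integral>x. p x * ln (p x / q x) \<partial>lborel)"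
    unfolding dens_def using q
    by (subst integral_real_density) (auto simp: less_imp_le qe[unfolded times_divide_eq_right times_divide_eq_left])
  finally have ie: "(\<integral>x. f x * ln (f x) \<partial>dens q) = (\<integral>x. p x * ln (p x / q x) \<partial>lborel)" .
  show ?thesis
    unfolding KL_def Let_def using ac i2 ie by (simp add: f_def dens_def)
qed

lemma integrable_ball_cont:
  fixes h :: "'a::euclidean_space \<Rightarrow> real"
  assumes "continuous_on (cball 0 R) h"
  shows "integrable lborel (\<lambda>x. indicator (cball 0 R) x * h x)"
  using borel_integrable_compact[OF compact_cball assms]
  by (simp add: indicator_def if_distrib mult.commute cong: if_cong)

lemma rem_bound:
  fixes r s :: real assumes "0 < r" "0 < r + s"
  shows "0 \<le> (r+s) * ln ((r+s)/r) - s" "(r+s) * ln ((r+s)/r) - s \<le> s^2 / r"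
proof -
  have "ln (r/(r+s)) \<le> r/(r+s) - 1" using assms by (intro ln_le_minus_one) simp
  then have "- ln ((r+s)/r) \<le> r/(r+s) - 1" using assms by (simp add: ln_div)
  then have "(r+s) * (- ln ((r+s)/r)) \<le> (r+s) * (r/(r+s) - 1)" using assms by (intro mult_left_mono) auto
  also have "\<dots> = - s" using assms by (simp add: field_simps)
  finally show "0 \<le> (r+s) * ln ((r+s)/r) - s" by (simp add: algebra_simps)
  have "ln ((r+s)/r) \<le> (r+s)/r - 1" using assms by (intro ln_le_minus_one) simp
  then have "(r+s) * ln ((r+s)/r) \<le> (r+s) * ((r+s)/r - 1)" using assms by (intro mult_left_mono) auto
  also have "\<dots> = s + s^2/r" using assms by (simp add: field_simps power2_eq_square)
  finally show "(r+s) * ln ((r+s)/r) - s \<le> s^2 / r" by simp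
qed

text \<open>No finiteness of \<open>KL[e^{-V}|e^{-U}]\<close> is needed.\<close>

lemma first_variation_KL:
  fixes U V :: "'a::euclidean_space \<Rightarrow> real"
  assumes cU: "continuous_on UNIV U" and cV: "continuous_on UNIV V" and pU: "prob_space (gibbs U)"
  shows "first_variation (\<lambda>\<rho>. KL \<rho> (gibbs U)) (\<lambda>x. exp (- V x)) (\<lambda>x. 1 + U x - V x)"
  unfolding first_variation_def
proof (intro conjI allI impI)
  show "continuous_on UNIV (\<lambda>x. 1 + U x - V x)" by (intro continuous_intros cU cV)
  fix \<eta> :: "'a \<Rightarrow> real" and R :: real
  assume "continuous_on UNIV \<eta> \<and> (\<forall>x. x \<notin> cball 0 R \<longrightarrow> \<eta> x = 0) \<and> (\<integral>x. \<eta> x \<partial>lborel) = 0"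
  then have c: "continuous_on UNIV \<eta>" and z: "\<And>x. x \<notin> cball 0 R \<Longrightarrow> \<eta> x = 0" by auto
  define B where "B = cball (0::'a) R"
  define r where "r = (\<lambda>x. exp (- V x))"
  have cr: "continuous_on UNIV r" unfolding r_def by (intro continuous_intros cV)
  have rpos: "r x > 0" for x by (simp add: r_def)
  have cs: "continuous_on S U" "continuous_on S V" "continuous_on S \<eta>" "continuous_on S r" for S
    using cU cV c cr continuous_on_subset by blast+
  have [measurable]: "U \<in> borel_measurable borel" "V \<in> borel_measurable borel" "\<eta> \<in> borel_measurable borel" "r \<in> borel_measurable borel"
    using cU cV c cr by (auto intro: borel_measurable_continuous_onI)
  have bB[measurable]: "B \<in> sets borel" by (simp add: B_def)
  define G where "G = (\<lambda>\<epsilon>. KL (dens (\<lambda>x. indicator B x * (r x + \<epsilon> * \<eta> x))) (gibbs U))"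
  define H where "H = (\<lambda>\<epsilon>. \<integral>x. indicator B x * ((r x + \<epsilon> * \<eta> x) * (ln (r x + \<epsilon> * \<eta> x) + U x)) \<partial>lborel)"
  define D where "D = (\<integral>x. (1 + U x - V x) * \<eta> x \<partial>lborel)"
  have D_eq: "D = (\<integral>x. indicator B x * ((1 + U x - V x) * \<eta> x) \<partial>lborel)"
    unfolding D_def by (intro Bochner_Integration.integral_cong) (use z in \<open>auto simp: B_def indicator_def\<close>)
  have "\<exists>d>0. \<forall>\<epsilon>. \<bar>\<epsilon>\<bar> < d \<longrightarrow> (\<forall>x\<in>B. 0 < r x + \<epsilon> * \<eta> x)"
  proof (cases "B = {}")
    case True then show ?thesis by (intro exI[of _ 1]) auto
  next
    case False
    have "\<exists>x\<in>B. \<forall>y\<in>B. \<bar>\<eta> y\<bar> / r y \<le> \<bar>\<eta> x\<bar> / r x"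
      using False rpos by (intro continuous_attains_sup continuous_intros cs) (auto simp: B_def less_imp_neq[symmetric] intro: less_imp_neq[symmetric])
    then obtain x where x: "\<forall>y\<in>B. \<bar>\<eta> y\<bar> / r y \<le> \<bar>\<eta> x\<bar> / r x" by blast
    define C where "C = \<bar>\<eta> x\<bar> / r x + 1"
    have Cp: "C > 0" unfolding C_def using rpos[of x] by (simp add: add_nonneg_pos)
    have "0 < r y + \<epsilon> * \<eta> y" if "\<bar>\<epsilon>\<bar> < 1 / C" "y \<in> B" for \<epsilon> y
    proof -
      have "\<bar>\<eta> y\<bar> / r y \<le> C" using x that by (force simp: C_def)
      then have "\<bar>\<eta> y\<bar> \<le> C * r y" using rpos[of y] by (simp add: divide_simps)
      then have "\<bar>\<epsilon>\<bar> * \<bar>\<eta> y\<bar> \<le> \<bar>\<epsilon>\<bar> * (C * r y)" by (intro mult_left_mono) auto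
      also have "\<dots> < 1 / C * (C * r y)" using that Cp rpos[of y] by (intro mult_strict_right_mono) auto
      also have "\<dots> = r y" using Cp by simp
      finally have "\<bar>\<epsilon> * \<eta> y\<bar> < r y" by (simp add: abs_mult)
      then show ?thesis by linarith
    qed
    then show ?thesis using Cp by (intro exI[of _ "1 / C"]) auto
  qed
  then obtain d where d: "d > 0" and pos: "\<And>\<epsilon> x. \<bar>\<epsilon>\<bar> < d \<Longrightarrow> x \<in> B \<Longrightarrow> 0 < r x + \<epsilon> * \<eta> x" by blast
  have intH: "integrable lborel (\<lambda>x. indicator B x * ((r x + \<epsilon> * \<eta> x) * (ln (r x + \<epsilon> * \<eta> x) + U x)))" if "\<bar>\<epsilon>\<bar> < d" for \<epsilon>
    unfolding B_def using pos[OF that]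
    by (intro integrable_ball_cont continuous_intros cs) (force simp: B_def)
  have GH: "G \<epsilon> = ereal (H \<epsilon>)" if "\<bar>\<epsilon>\<bar> < d" for \<epsilon>
  proof -
    let ?p = "\<lambda>x. indicator B x * (r x + \<epsilon> * \<eta> x)" let ?q = "\<lambda>x. exp (- U x)"
    have e: "?p x * ln (?p x / ?q x) = indicator B x * ((r x + \<epsilon> * \<eta> x) * (ln (r x + \<epsilon> * \<eta> x) + U x))" for x
      using pos[OF that, of x] by (auto simp: indicator_def ln_div)
    have "G \<epsilon> = ereal (\<integral>x. ?p x * ln (?p x / ?q x) \<partial>lborel)"
      unfolding G_def gibbs_def
    proof (rule KL_dens)
      show "0 \<le> ?p x" for x using pos[OF that, of x] by (auto simp: indicator_def)
      show "prob_space (dens ?q)" using pU by (simp add: gibbs_def)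
      show "integrable lborel (\<lambda>x. ?p x * ln (?p x / ?q x))" unfolding e by (rule intH[OF that])
      show "?p \<in> borel_measurable borel" by measurable
      show "?q \<in> borel_measurable borel" by measurable
    qed simp
    then show ?thesis unfolding e H_def .
  qed
  have intD: "integrable lborel (\<lambda>x. indicator B x * ((1 + U x - V x) * \<eta> x))"
    unfolding B_def by (intro integrable_ball_cont continuous_intros cs)
  define K where "K = (\<integral>x. indicator B x * ((\<eta> x)^2 / r x) \<partial>lborel)"
  have intK: "integrable lborel (\<lambda>x. indicator B x * ((\<eta> x)^2 / r x))"
    unfolding B_def using rpos by (intro integrable_ball_cont continuous_intros cs) (auto simp: less_imp_neq[symmetric])
  have bound: "\<bar>H \<epsilon> - H 0 - \<epsilon> * D\<bar> \<le> K * \<epsilon>^2" if e: "\<bar>\<epsilon>\<bar> < d" for \<epsilon>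
  proof -
    let ?f = "\<lambda>\<epsilon> x. indicator B x * ((r x + \<epsilon> * \<eta> x) * (ln (r x + \<epsilon> * \<eta> x) + U x))"
    let ?g = "\<lambda>x. indicator B x * ((1 + U x - V x) * \<eta> x)"
    have e0: "\<bar>0::real\<bar> < d" using d by simp
    have eq: "H \<epsilon> - H 0 - \<epsilon> * D = (\<integral>x. ?f \<epsilon> x - ?f 0 x - \<epsilon> * ?g x \<partial>lborel)"
      unfolding H_def D_eq using intH[OF e] intH[OF e0] intD by simp
    have pt: "?f \<epsilon> x - ?f 0 x - \<epsilon> * ?g x = indicator B x * ((r x + \<epsilon> * \<eta> x) * ln ((r x + \<epsilon> * \<eta> x) / r x) - \<epsilon> * \<eta> x)" for x
    proof (cases "x \<in> B")
      case True
      have i: "indicator B x = (1::real)" using True by simp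
      have lr: "ln (r x) = - V x" by (simp add: r_def)
      have lq: "ln ((r x + \<epsilon> * \<eta> x) / r x) = ln (r x + \<epsilon> * \<eta> x) - ln (r x)"
        using pos[OF e True] rpos[of x] by (simp add: ln_div)
      show ?thesis unfolding i lq lr mult_zero_left add_0_right by algebra
    qed simp
    have b0: "0 \<le> ?f \<epsilon> x - ?f 0 x - \<epsilon> * ?g x" for x
      unfolding pt using rem_bound(1)[OF rpos pos[OF e], of x] by (auto simp: indicator_def)
    have b1: "?f \<epsilon> x - ?f 0 x - \<epsilon> * ?g x \<le> indicator B x * ((\<eta> x)^2 / r x) * \<epsilon>^2" for x
      unfolding pt using rem_bound(2)[OF rpos pos[OF e], of x] 
      by (auto simp: indicator_def power_mult_distrib mult.commute[of "\<epsilon>\<^sup>2"])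
    have "0 \<le> H \<epsilon> - H 0 - \<epsilon> * D" unfolding eq using b0 by (intro Bochner_Integration.integral_nonneg)
    moreover have "H \<epsilon> - H 0 - \<epsilon> * D \<le> (\<integral>x. indicator B x * ((\<eta> x)^2 / r x) * \<epsilon>^2 \<partial>lborel)"
      unfolding eq
      by (intro integral_mono b1 Bochner_Integration.integrable_diff integrable_mult_right
          integrable_mult_left intH e e0 intD intK)
    moreover have "(\<integral>x. indicator B x * ((\<eta> x)^2 / r x) * \<epsilon>^2 \<partial>lborel) = K * \<epsilon>^2"
      unfolding K_def by (rule integral_mult_left_zero)
    ultimately show ?thesis by linarith
  qed
  have ev: "\<forall>\<^sub>F \<epsilon> in nhds 0. \<bar>\<epsilon>\<bar> < d"
    using d by (auto simp: eventually_nhds_metric dist_real_def)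
  have derH: "(H has_real_derivative D) (at 0)"
  proof -
    have "((\<lambda>h. (H (0 + h) - H 0) / h - D) \<longlongrightarrow> 0) (at 0)"
    proof (rule Lim_null_comparison)
      show "\<forall>\<^sub>F h in at 0. norm ((H (0 + h) - H 0) / h - D) \<le> K * \<bar>h\<bar>"
        using filter_leD[OF at_within_le_nhds ev] eventually_neq_at_within[of 0 0 UNIV]
      proof eventually_elim
        case (elim h)
        have "(H (0 + h) - H 0) / h - D = (H h - H 0 - h * D) / h" using elim by (simp add: field_simps)
        then have "norm ((H (0 + h) - H 0) / h - D) = \<bar>H h - H 0 - h * D\<bar> / \<bar>h\<bar>" by simp
        also have "\<dots> \<le> K * h^2 / \<bar>h\<bar>" by (intro divide_right_mono bound elim) auto
        also have "\<dots> = K * \<bar>h\<bar>" using elim by (simp add: power2_eq_square field_simps abs_if)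
        finally show ?case .
      qed
      show "((\<lambda>h. K * \<bar>h\<bar>) \<longlongrightarrow> 0) (at 0)" by (auto intro!: tendsto_eq_intros)
    qed
    then show ?thesis unfolding DERIV_def by (simp add: LIM_zero_iff)
  qed
  have evG: "\<forall>\<^sub>F \<epsilon> in nhds 0. real_of_ereal (G \<epsilon>) = H \<epsilon>" using ev by eventually_elim (simp add: GH)
  have "((\<lambda>\<epsilon>. real_of_ereal (G \<epsilon>)) has_real_derivative D) (at 0)"
    using derH DERIV_cong_ev[OF refl evG refl] by blast
  moreover have "\<forall>\<^sub>F \<epsilon> in nhds 0. \<bar>G \<epsilon>\<bar> \<noteq> \<infinity>" using ev by eventually_elim (simp add: GH)
  ultimately show "let G = (\<lambda>\<epsilon>. KL (dens (\<lambda>x. indicator (cball 0 R) x * (exp (- V x) + \<epsilon> * \<eta> x))) (gibbs U)) in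
         (\<forall>\<^sub>F \<epsilon> in nhds 0. \<bar>G \<epsilon>\<bar> \<noteq> \<infinity>) \<and>
         ((\<lambda>\<epsilon>. real_of_ereal (G \<epsilon>)) has_real_derivative (\<integral>x. (1 + U x - V x) * \<eta> x \<partial>lborel)) (at 0)"
    unfolding Let_def G_def B_def r_def D_def by blast
qed

end

theory Submission
  imports Defs
begin

text \<open>The first variation is \<open>\<phi> = 1 + U - V0\<close> up to a constant, so \<open>T0\<close> has Jacobian
  \<open>A = I - h0 (Hess U - Hess V0)\<close>, and the Hessian bounds give \<open>A \<succeq> (1 - h0 (M + M0)) I\<close> with a positive factor.
  Hence \<open>T0\<close> is strongly monotone and expanding. It is injective with Lipschitz inverse, and surjective because
  its range is closed and, by invariance of domain, open. The change of variables formula yields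
  \<open>V1 = (V0 + ln |det A|) \<circ> T0\<^sup>-\<^sup>1\<close>, where \<open>T0\<close> and its inverse are \<open>C\<^sup>m\<^sup>+\<^sup>1\<close> and \<open>A\<close> is only \<open>C\<^sup>m\<close>.\<close>

section \<open>Functions of class \<open>C\<^sup>k\<close>\<close>

text \<open>Derivatives are unique, so a formula \<open>f'\<close> obtained from the calculus rules
  may replace \<open>frechet_derivative\<close>. The closure proofs below apply the matching
  differentiation rule through this equivalence.\<close>

lemma C_k_Suc_iff:
  assumes "\<And>x. (f has_derivative f' x) (at x)"
  shows "C_k (Suc k) f \<longleftrightarrow> (\<forall>b\<in>Basis. C_k k (\<lambda>x. f' x b))"
proof -
  have "frechet_derivative f (at x) = f' x" for x
    using frechet_derivative_at[OF assms] by simp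
  then show ?thesis
    using assms by (auto simp: differentiable_def)
qed

lemma C_k_SucD:
  assumes "C_k (Suc k) f"
  shows "(f has_derivative frechet_derivative f (at x)) (at x)"
    and "b \<in> Basis \<Longrightarrow> C_k k (\<lambda>x. frechet_derivative f (at x) b)"
  using assms by (auto simp: frechet_derivative_works)

lemma C_k_Suc_imp_C_k: "C_k (Suc k) f \<Longrightarrow> C_k k f"
proof (induction k arbitrary: f)
  case 0
  then show ?case
    by (auto intro!: differentiable_imp_continuous_on simp: differentiable_on_def
        intro: differentiable_at_withinI)
next
  case (Suc k)
  then show ?case by (metis C_k.simps(2))
qed

lemma C_k_mono: "C_k n f \<Longrightarrow> k \<le> n \<Longrightarrow> C_k k f"
  by (induction n rule: nat_induct) (auto simp: le_Suc_eq dest: C_k_Suc_imp_C_k simp del: C_k.simps(2))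

lemma C_k_continuous: "C_k k f \<Longrightarrow> continuous_on UNIV f"
  using C_k_mono[of k f 0] by simp

lemma C_k_const: "C_k k (\<lambda>x. c)"
proof (induction k arbitrary: c)
  case (Suc k)
  show ?case
    by (subst C_k_Suc_iff[where f'="\<lambda>_ _. 0"]) (auto simp: Suc)
qed simp

lemma C_k_linear:
  assumes "bounded_linear L"
  shows "C_k k L"
proof (cases k)
  case 0
  then show ?thesis by (simp add: assms linear_continuous_on)
next
  case (Suc j)
  then show ?thesis
    using bounded_linear_imp_has_derivative[OF assms]
    by (simp only: C_k_Suc_iff[where f'="\<lambda>_. L"] C_k_const) simp
qed

lemma C_k_add:
  assumes "C_k k f" "C_k k g"
  shows "C_k k (\<lambda>x. f x + g x)"
  using assms
proof (induction k arbitrary: f g)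
  case 0
  then show ?case by (simp add: continuous_on_add)
next
  case (Suc k)
  show ?case
    by (subst C_k_Suc_iff[OF has_derivative_add[OF Suc.prems[THEN C_k_SucD(1)]]])
      (intro ballI Suc.IH Suc.prems[THEN C_k_SucD(2)])
qed

lemma C_k_sum:
  assumes "\<And>i. i \<in> I \<Longrightarrow> C_k k (f i)"
  shows "C_k k (\<lambda>x. \<Sum>i\<in>I. f i x)"
  using assms by (induction I rule: infinite_finite_induct) (auto intro: C_k_add C_k_const)

text \<open>By the product rule each directional derivative is a sum of two terms of the form
  \<open>B\<close>, pairing one factor with a derivative of the other. Hence the induction
  generalises over both \<open>f\<close> and \<open>g\<close>.\<close>

lemma C_k_bilinear:
  assumes "bounded_bilinear B" "C_k k f" "C_k k g"
  shows "C_k k (\<lambda>x. B (f x) (g x))"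
  using assms(2,3)
proof (induction k arbitrary: f g)
  case 0
  then show ?case by (simp add: bounded_bilinear.continuous_on[OF assms(1)])
next
  case (Suc k)
  show ?case
    by (subst C_k_Suc_iff[OF bounded_bilinear.FDERIV[OF assms(1) Suc.prems[THEN C_k_SucD(1)]]])
      (intro ballI C_k_add Suc Suc.prems[THEN C_k_SucD(2)] Suc.prems[THEN C_k_Suc_imp_C_k])
qed

lemmas C_k_scaleR = C_k_bilinear[OF bounded_bilinear_scaleR]
lemmas C_k_mult = C_k_bilinear[OF bounded_bilinear_mult]
lemmas C_k_inner = C_k_bilinear[OF bounded_bilinear_inner]

lemma C_k_prod:
  fixes f :: "'i \<Rightarrow> 'a::euclidean_space \<Rightarrow> real"
  assumes "\<And>i. i \<in> I \<Longrightarrow> C_k k (f i)"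
  shows "C_k k (\<lambda>x. \<Prod>i\<in>I. f i x)"
  using assms by (induction I rule: infinite_finite_induct) (auto intro: C_k_mult C_k_const)

lemma C_k_compose:
  fixes f :: "'b::euclidean_space \<Rightarrow> 'c::real_normed_vector" and g :: "'a::euclidean_space \<Rightarrow> 'b"
  assumes "C_k k f" "C_k k g"
  shows "C_k k (\<lambda>x. f (g x))"
  using assms
proof (induction k arbitrary: f g)
  case 0
  then show ?case by (auto intro: continuous_on_compose2)
next
  case (Suc k)
  let ?f' = "\<lambda>x. frechet_derivative f (at x)" and ?g' = "\<lambda>x. frechet_derivative g (at x)"
  \<comment> \<open>The chain rule evaluates the derivative of \<open>f\<close> in the moving
    direction \<open>?g' x h\<close>, whereas \<open>C_k\<close> controls only fixed basis
    directions. Expanding in the basis separates the moving coefficients from the partial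
    derivatives of \<open>f\<close>.\<close>
  have "?f' (g x) (?g' x h) = (\<Sum>i\<in>Basis. (?g' x h \<bullet> i) *\<^sub>R ?f' (g x) i)" for x h
  proof -
    interpret bounded_linear "?f' (g x)"
      using C_k_SucD(1)[OF Suc.prems(1)] has_derivative_bounded_linear by blast
    show ?thesis
      by (subst euclidean_representation[symmetric, of "?g' x h"]) (simp add: sum scaleR)
  qed
  then have "((\<lambda>x. f (g x)) has_derivative (\<lambda>h. \<Sum>i\<in>Basis. (?g' x h \<bullet> i) *\<^sub>R ?f' (g x) i)) (at x)" for x
    using has_derivative_compose[OF C_k_SucD(1)[OF Suc.prems(2)] C_k_SucD(1)[OF Suc.prems(1)]] by simp
  moreover have "C_k k (\<lambda>x. \<Sum>i\<in>Basis. (?g' x b \<bullet> i) *\<^sub>R ?f' (g x) i)" if "b \<in> Basis" for b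
    by (intro C_k_sum C_k_scaleR C_k_inner C_k_const C_k_SucD(2)[OF Suc.prems(2) that]
        Suc.IH C_k_SucD(2)[OF Suc.prems(1)] C_k_Suc_imp_C_k[OF Suc.prems(2)])
  ultimately show ?case
    by (subst C_k_Suc_iff) auto
qed

lemma C_k_linear_compose:
  fixes L :: "'b::euclidean_space \<Rightarrow> 'c::real_normed_vector"
  assumes "bounded_linear L" "C_k k g"
  shows "C_k k (\<lambda>x. L (g x))"
  using C_k_compose[OF C_k_linear[OF assms(1)] assms(2)] .

text \<open>Extends the control of partial derivatives from basis vectors to an arbitrary fixed
  direction, by linearity.\<close>

lemma C_k_derivative:
  fixes f :: "'a::euclidean_space \<Rightarrow> 'b::real_normed_vector"
  assumes f: "C_k (Suc k) f" and f': "\<And>x. (f has_derivative f' x) (at x)"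
  shows "C_k k (\<lambda>x. f' x w)"
proof -
  have "f' x w = (\<Sum>b\<in>Basis. (w \<bullet> b) *\<^sub>R f' x b)" for x
  proof -
    interpret bounded_linear "f' x"
      using f' has_derivative_bounded_linear by blast
    show ?thesis
      by (subst euclidean_representation[symmetric, of w]) (simp add: sum scaleR)
  qed
  moreover have "C_k k (\<lambda>x. f' x b)" if "b \<in> Basis" for b
    using f that C_k_Suc_iff[OF f'] by blast
  ultimately show ?thesis
    by (simp add: C_k_sum C_k_scaleR C_k_const)
qed

lemma C_k_vec:
  fixes f :: "'i::finite \<Rightarrow> 'a::euclidean_space \<Rightarrow> real"
  assumes "\<And>i. C_k k (f i)"
  shows "C_k k (\<lambda>x. \<chi> i. f i x)"
proof -
  have "(\<lambda>x. \<chi> i. f i x) = (\<lambda>x. \<Sum>i\<in>UNIV. f i x *\<^sub>R axis i 1)"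
    by (auto simp: vec_eq_iff axis_def if_distrib cong: if_cong)
  then show ?thesis
    by (simp add: C_k_sum C_k_scaleR C_k_const assms)
qed

text \<open>The derivative of \<open>1/f\<close> contains \<open>f\<close> only through
  \<open>1/f\<close> and the derivative of \<open>f\<close>, so the induction hypothesis for the
  same \<open>f\<close> covers every factor.\<close>

lemma C_k_inverse:
  fixes f :: "'a::euclidean_space \<Rightarrow> real"
  assumes "C_k k f" and nz: "\<And>x. f x \<noteq> 0"
  shows "C_k k (\<lambda>x. inverse (f x))"
  using assms(1)
proof (induction k)
  case 0
  then show ?case using nz by (auto intro: continuous_on_inverse)
next
  case (Suc k)
  let ?f' = "\<lambda>x. frechet_derivative f (at x)"
  have "((\<lambda>x. inverse (f x)) has_derivative (\<lambda>h. - 1 * (inverse (f x) * ?f' x h * inverse (f x)))) (at x)" for x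
    using Deriv.has_derivative_inverse[OF nz C_k_SucD(1)[OF Suc.prems]] by simp
  moreover have "C_k k (\<lambda>x. - 1 * (inverse (f x) * ?f' x b * inverse (f x)))" if "b \<in> Basis" for b
    by (intro C_k_mult C_k_const Suc.IH C_k_Suc_imp_C_k[OF Suc.prems] C_k_SucD(2)[OF Suc.prems that])
  ultimately show ?case
    by (subst C_k_Suc_iff) auto
qed

lemma C_k_ln:
  fixes f :: "'a::euclidean_space \<Rightarrow> real"
  assumes "C_k k f" and pos: "\<And>x. 0 < f x"
  shows "C_k k (\<lambda>x. ln (f x))"
proof (cases k)
  case 0
  have "f x \<noteq> 0" for x
    using pos[of x] by simp
  then show ?thesis using 0 assms(1) by (simp add: continuous_on_ln)
next
  case (Suc j)
  have f: "C_k (Suc j) f" using assms(1) Suc by simp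
  let ?f' = "\<lambda>x. frechet_derivative f (at x)"
  have nz: "f x \<noteq> 0" for x
    using pos[of x] by simp
  have "((\<lambda>x. ln (f x)) has_derivative (\<lambda>h. ?f' x h * inverse (f x))) (at x)" for x
    using has_derivative_ln[OF pos C_k_SucD(1)[OF f]] by simp
  moreover have "C_k j (\<lambda>x. ?f' x b * inverse (f x))" if "b \<in> Basis" for b
    by (intro C_k_mult C_k_inverse C_k_Suc_imp_C_k[OF f] C_k_SucD(2)[OF f that] nz)
  ultimately show ?thesis
    unfolding Suc by (subst C_k_Suc_iff) auto
qed

text \<open>Squaring removes the absolute value: \<open>ln |f|\<close> is half of
  \<open>ln (f^2)\<close>, so the sign of \<open>f\<close> need not be tracked.\<close>

lemma C_k_ln_abs:
  fixes f :: "'a::euclidean_space \<Rightarrow> real"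
  assumes "C_k k f" and "\<And>x. f x \<noteq> 0"
  shows "C_k k (\<lambda>x. ln \<bar>f x\<bar>)"
proof -
  have "ln \<bar>f x\<bar> = 1 / 2 * ln ((f x)\<^sup>2)" for x
    using ln_realpow[of "\<bar>f x\<bar>" 2] assms(2)[of x] by simp
  moreover have "C_k k (\<lambda>x. 1 / 2 * ln ((f x)\<^sup>2))"
    unfolding power2_eq_square
    by (intro C_k_mult C_k_const C_k_ln assms) (use assms(2) in \<open>simp flip: power2_eq_square\<close>)
  ultimately show ?thesis by presburger
qed

lemma C_k_det:
  fixes A :: "'a::euclidean_space \<Rightarrow> real^'n^'n"
  assumes "\<And>i j. C_k k (\<lambda>x. A x $ i $ j)"
  shows "C_k k (\<lambda>x. det (A x))"
  unfolding det_def by (intro C_k_sum C_k_mult C_k_const C_k_prod assms)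

text \<open>Bootstrapping: the derivative of \<open>S\<close> at \<open>y\<close> is the inverse of
  the matrix \<open>A (S y)\<close>. If \<open>S\<close> is C^k, then so are the entries of that
  inverse, which makes \<open>S\<close> C^(k+1).\<close>

lemma C_k_inverse_function:
  fixes T S :: "real^'n \<Rightarrow> real^'n"
  assumes T: "C_k k T" and T': "\<And>x. (T has_derivative (*v) (A x)) (at x)"
    and A: "\<And>x. det (A x) \<noteq> 0"
    and S: "continuous_on UNIV S" and TS: "\<And>y. T (S y) = y"
  shows "C_k k S"
  using T
proof (induction k)
  case 0
  then show ?case using S by simp
next
  case (Suc k)
  let ?R = "\<lambda>y. matrix_inv (A (S y))"
  have inv: "A (S y) ** ?R y = mat 1" "?R y ** A (S y) = mat 1" for y
    using someI_ex[of "\<lambda>B. A (S y) ** B = mat 1 \<and> B ** A (S y) = mat 1"] A[of "S y"]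
    unfolding matrix_inv_def invertible_det_nz[symmetric] invertible_def by blast+
  have S': "(S has_derivative (*v) (?R y)) (at y)" for y
  \<comment> \<open>A continuous right inverse is differentiable wherever the derivative of the map
    is invertible.\<close>
  proof (rule has_derivative_inverse_basic[OF T', where T=UNIV])
    show "(*v) (?R y) \<circ> (*v) (A (S y)) = id"
      by (auto simp: fun_eq_iff matrix_vector_mul_assoc inv)
    show "continuous (at y) S"
      using S by (simp add: continuous_on_eq_continuous_at)
  qed (auto simp: TS matrix_vector_mul_bounded_linear)
  have CA: "C_k k (\<lambda>x. A x $ i $ j)" for i j
  proof -
    have "C_k k (\<lambda>x. A x *v axis j 1)"
      using C_k_derivative[OF Suc.prems T'] .
    then have "C_k k (\<lambda>x. (A x *v axis j 1) $ i)"
      by (rule C_k_linear_compose[OF bounded_linear_vec_nth])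
    then show ?thesis
      by (simp add: matrix_vector_mult_basis column_def)
  qed
  have CAS: "C_k k (\<lambda>y. A (S y) $ i $ j)" for i j
    using C_k_compose[OF CA Suc.IH[OF C_k_Suc_imp_C_k[OF Suc.prems]]] .
  have "C_k k (\<lambda>y. ?R y *v b)" for b
  proof -
    \<comment> \<open>Cramer's rule expresses the inverse matrix by determinants and one reciprocal,
      for which C^k closure is already known.\<close>
    have "?R y *v b = (\<chi> l. det (\<chi> i j. if j = l then b $ i else A (S y) $ i $ j) * inverse (det (A (S y))))" for y
      using cramer[OF A[of "S y"], THEN iffD1, of "?R y *v b" b]
      by (simp add: matrix_vector_mul_assoc inv divide_inverse)
    moreover have "C_k k (\<lambda>y. if j = l then b $ i else A (S y) $ i $ j)" for i j l
      by (cases "j = l") (simp_all add: C_k_const CAS)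
    ultimately show ?thesis
      by (simp add: C_k_vec C_k_mult C_k_det C_k_inverse A CAS)
  qed
  then show ?case
    by (simp add: C_k_Suc_iff[OF S'] del: C_k.simps)
qed

section \<open>Pushforward of Gibbs measures\<close>

text \<open>The library's change of variables formula needs a well-ordered index type. Coordinates are therefore
  relabelled by a well-ordered copy of \<open>'n\<close>, which preserves Lebesgue measure. The Jacobian determinant is
  taken in the copy throughout, so no invariance of \<open>det\<close> under relabelling is needed.\<close>

typedef 'a wellordered = "UNIV :: 'a set" ..

instance wellordered :: (finite) finite
proof
  have "inj (Rep_wellordered :: 'a wellordered \<Rightarrow> 'a)"
    by (simp add: inj_def Rep_wellordered_inject)
  then show "finite (UNIV :: 'a wellordered set)"
    by (rule finite_imageD[OF finite_subset[OF subset_UNIV finite]])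
qed

instantiation wellordered :: (finite) wellorder
begin

definition "x \<le> y \<longleftrightarrow> to_nat (Rep_wellordered x) \<le> to_nat (Rep_wellordered y)"
definition "(x :: 'a wellordered) < y \<longleftrightarrow> to_nat (Rep_wellordered x) < to_nat (Rep_wellordered y)"

instance
proof
  fix P :: "'a wellordered \<Rightarrow> bool" and a :: "'a wellordered"
  assume *: "\<And>x. (\<And>y. y < x \<Longrightarrow> P y) \<Longrightarrow> P x"
  show "P a"
    by (induction a rule: measure_induct_rule[of "\<lambda>x. to_nat (Rep_wellordered x)"])
      (rule *, simp add: less_wellordered_def)
qed (auto simp: less_eq_wellordered_def less_wellordered_def Rep_wellordered_inject)

end

lemma bij_Rep_wellordered: "bij Rep_wellordered"
  unfolding bij_def inj_def by (auto simp: Rep_wellordered_inject) (metis Abs_wellordered_inverse UNIV_I rangeI)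

text \<open>Pullback along \<open>p\<close>, hence contravariant: a map of indices from
  \<open>'a\<close> to \<open>'b\<close> sends vectors over \<open>'b\<close> to vectors over
  \<open>'a\<close>.\<close>

definition reindex :: "('a \<Rightarrow> 'b) \<Rightarrow> real^'b::finite \<Rightarrow> real^'a::finite" where
  "reindex p x = (\<chi> i. x $ p i)"

lemma bounded_linear_reindex: "bounded_linear (reindex p)"
  by (rule linear_conv_bounded_linear[THEN iffD1], rule linearI) (simp_all add: reindex_def vec_eq_iff)

lemma continuous_reindex: "continuous_on S (reindex p)"
  by (rule linear_continuous_on[OF bounded_linear_reindex])

lemma measurable_reindex [measurable]: "reindex p \<in> borel \<rightarrow>\<^sub>M borel"
  by (rule borel_measurable_continuous_onI[OF continuous_reindex])

lemma reindex_reindex: "(\<And>i. p (q i) = i) \<Longrightarrow> reindex q (reindex p x) = x"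
  by (simp add: reindex_def vec_eq_iff)

text \<open>Lebesgue measure is determined by its values on boxes. The preimage of a box is a box
  with the same side lengths in another order, so the volume product is unchanged.\<close>

lemma distr_lborel_reindex:
  fixes p :: "'a::finite \<Rightarrow> 'b::finite"
  assumes p: "bij p"
  shows "distr lborel borel (reindex p) = lborel"
proof (rule lborel_eqI[symmetric])
  fix l u :: "real^'a"
  assume lu: "\<And>b. b \<in> Basis \<Longrightarrow> l \<bullet> b \<le> u \<bullet> b"
  have pi: "p (inv p i) = i" "inv p (p j) = j" for i j
    using p by (simp_all add: bij_is_surj surj_f_inv_f bij_is_inj inv_f_f)
  let ?q = "reindex (inv p) :: real^'a \<Rightarrow> real^'b"
  have vim: "reindex p -` box l u = box (?q l) (?q u)"
    by (auto simp: mem_box_cart reindex_def pi) (metis pi)+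
  have le: "l $ i \<le> u $ i" for i
    using lu[of "axis i 1"] by (simp add: inner_axis)
  have UNIV_prod: "(\<Prod>b\<in>Basis. v \<bullet> b) = (\<Prod>i\<in>UNIV. v $ i)" for v :: "real^'c"
    by (simp add: Basis_vec_def UNION_singleton_eq_range prod.reindex inj_on_def axis_eq_axis inner_axis)
  have "emeasure (distr lborel borel (reindex p)) (box l u) = emeasure lborel (box (?q l) (?q u))"
    by (simp add: emeasure_distr vim)
  also have "\<dots> = (\<Prod>b\<in>Basis. (?q u - ?q l) \<bullet> b)"
    by (rule emeasure_lborel_box) (auto simp: Basis_vec_def inner_axis reindex_def le)
  also have "\<dots> = (\<Prod>b\<in>Basis. (u - l) \<bullet> b)"
    unfolding UNIV_prod using prod.reindex_bij_betw[OF p, of "\<lambda>i. (?q u - ?q l) $ i"]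
    by (simp add: reindex_def pi)
  finally show "emeasure (distr lborel borel (reindex p)) (box l u) = (\<Prod>b\<in>Basis. (u - l) \<bullet> b)" .
qed simp

section \<open>Change of variables for Gibbs measures\<close>

lemma sets_gibbs [simp, measurable_cong]: "sets (gibbs V) = sets borel"
  by (simp add: gibbs_def dens_def)

lemma distr_gibbs_reindex:
  fixes p :: "'a::finite \<Rightarrow> 'b::finite"
  assumes p: "bij p" and [measurable]: "W \<in> borel_measurable borel"
  shows "distr (gibbs (\<lambda>x. W (reindex p x))) borel (reindex p) = gibbs W"
proof -
  have "gibbs W = density (distr lborel borel (reindex p)) (\<lambda>x. ennreal (exp (- W x)))"
    by (simp add: gibbs_def dens_def distr_lborel_reindex[OF p])
  also have "\<dots> = distr (gibbs (\<lambda>x. W (reindex p x))) borel (reindex p)"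
    unfolding gibbs_def dens_def by (rule density_distr) measurable
  finally show ?thesis by simp
qed

text \<open>\<open>W_eq\<close> is the logarithm of the Jacobian equation
  \<open>exp (- V x) = |det| * exp (- W (T x))\<close>. Integrating it over the preimage of
  \<open>A\<close> gives equal mass to \<open>A\<close> under both measures.\<close>

lemma distr_gibbs_change_of_variables_wellorder:
  fixes T :: "real^'n::{finite,wellorder} \<Rightarrow> real^'n::_"
  assumes pV: "prob_space (gibbs V)" and V[measurable]: "V \<in> borel_measurable borel"
    and W[measurable]: "W \<in> borel_measurable borel"
    and T': "\<And>x. (T has_derivative T' x) (at x)"
    and T: "bij T"
    and J: "\<And>x. det (matrix (T' x)) \<noteq> 0"
    and W_eq: "\<And>x. W (T x) = V x + ln \<bar>det (matrix (T' x))\<bar>"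
  shows "distr (gibbs V) borel T = gibbs W"
proof (rule measure_eqI)
  fix A assume "A \<in> sets (distr (gibbs V) borel T)"
  then have A[measurable]: "A \<in> sets borel" by simp
  have "continuous_on UNIV T"
    using T' by (auto intro: has_derivative_continuous_on has_derivative_at_withinI)
  then have [measurable]: "T \<in> borel \<rightarrow>\<^sub>M borel"
    by (rule borel_measurable_continuous_onI)
  let ?B = "T -` A"
  have B[measurable]: "?B \<in> sets borel"
    using measurable_sets[of T borel borel A] by simp
  have TB: "T ` ?B = A"
    using T by (simp add: bij_is_surj surj_image_vimage_eq)
  \<comment> \<open>The density is packed into \<open>real^1\<close> because the change of variables
    formula is applied to vector-valued integrands.\<close>
  define f where "f = (\<lambda>y. vec (exp (- W y)) :: real^1)"
  have fT: "\<bar>det (matrix (T' x))\<bar> *\<^sub>R f (T x) = vec (exp (- V x))" for x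
    using J[of x] by (simp add: f_def W_eq vec_eq_iff exp_add exp_minus exp_diff)
  interpret V: prob_space "gibbs V" by fact
  let ?b = "V.prob ?B"
  have nn: "(\<integral>\<^sup>+x. ennreal (indicator ?B x * exp (- V x)) \<partial>lborel) = ennreal ?b"
    by (subst V.emeasure_eq_measure[symmetric])
      (auto simp: gibbs_def dens_def emeasure_density intro!: nn_integral_cong split: split_indicator)
  \<comment> \<open>The mass of \<open>?B\<close> is finite, so it can be read as a gauge integral,
    the form in which the change of variables formula works.\<close>
  have "((\<lambda>x. indicator ?B x * exp (- V x)) has_integral ?b) UNIV"
    by (rule nn_integral_has_integral[OF _ _ nn]) auto
  then have "((\<lambda>x. exp (- V x)) has_integral ?b) ?B"
    by (subst has_integral_restrict_UNIV[symmetric])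
      (simp add: indicator_def of_bool_def if_distrib if_distribR mult.commute cong: if_cong)
  then have "(\<lambda>x. exp (- V x)) absolutely_integrable_on ?B \<and> integral ?B (\<lambda>x. exp (- V x)) = ?b"
    by (auto intro: nonnegative_absolutely_integrable_1 integral_unique has_integral_integrable)
  then have "(\<lambda>x. \<bar>det (matrix (T' x))\<bar> *\<^sub>R f (T x)) absolutely_integrable_on ?B \<and>
      integral ?B (\<lambda>x. \<bar>det (matrix (T' x))\<bar> *\<^sub>R f (T x)) = vec ?b"
    unfolding fT absolutely_integrable_on_1_iff integral_on_1_eq by simp
  then have "f absolutely_integrable_on (T ` ?B) \<and> integral (T ` ?B) f = vec ?b"
    by (subst (asm) has_absolute_integral_change_of_variables)
      (use T T' in \<open>auto intro: has_derivative_at_withinI inj_on_subset bij_is_inj\<close>)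
  then have "(\<lambda>y. exp (- W y)) absolutely_integrable_on A \<and> integral A (\<lambda>y. exp (- W y)) = ?b"
    unfolding TB f_def absolutely_integrable_on_1_iff integral_on_1_eq by (simp add: vec_eq_iff)
  then have "((\<lambda>y. exp (- W y)) has_integral ?b) A"
    by (metis has_integral_integral set_lebesgue_integral_eq_integral(1))
  then have "emeasure (gibbs W) A = ennreal ?b"
    using nn_integral_has_integral_lebesgue'[of A "\<lambda>y. exp (- W y)" ?b]
    by (simp add: gibbs_def dens_def emeasure_density)
  then show "emeasure (distr (gibbs V) borel T) A = emeasure (gibbs W) A"
    by (simp add: emeasure_distr V.emeasure_eq_measure gibbs_def[THEN arg_cong, of space] dens_def)
qed simp

text \<open>\<open>T\<close> is conjugated by the relabelling, the well-ordered case is applied to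
  the conjugate, and the result is pushed back to the original coordinates.\<close>

lemma distr_gibbs_change_of_variables:
  fixes T :: "real^'n \<Rightarrow> real^'n" and T' :: "real^'n \<Rightarrow> real^'n \<Rightarrow> real^'n"
  defines "p \<equiv> (Rep_wellordered :: 'n wellordered \<Rightarrow> 'n)"
  defines "J \<equiv> \<lambda>x. det (matrix (\<lambda>v. reindex p (T' x (reindex (inv p) v))))"
  assumes pV: "prob_space (gibbs V)" and V[measurable]: "V \<in> borel_measurable borel"
    and W[measurable]: "W \<in> borel_measurable borel"
    and T': "\<And>x. (T has_derivative T' x) (at x)"
    and T: "bij T"
    and J: "\<And>x. J x \<noteq> 0"
    and W_eq: "\<And>x. W (T x) = V x + ln \<bar>J x\<bar>"
  shows "distr (gibbs V) borel T = gibbs W"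
proof -
  define q where "q = inv p"
  have p: "bij p"
    unfolding p_def by (rule bij_Rep_wellordered)
  then have q: "bij q"
    by (simp add: q_def bij_imp_bij_inv)
  have "p (q i) = i" "q (p j) = j" for i j
    using p by (simp_all add: q_def bij_is_surj surj_f_inv_f bij_is_inj inv_f_f)
  then have pq [simp]: "reindex p (reindex q x) = x" "reindex q (reindex p y) = y" for x y
    by (simp_all add: reindex_reindex)
  have "continuous_on UNIV T"
    using T' by (auto intro: has_derivative_continuous_on has_derivative_at_withinI)
  then have [measurable]: "T \<in> borel \<rightarrow>\<^sub>M borel"
    by (rule borel_measurable_continuous_onI)
  let ?V = "\<lambda>x. V (reindex q x)" and ?W = "\<lambda>x. W (reindex q x)"
    and ?T = "\<lambda>x. reindex p (T (reindex q x))"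
    and ?T' = "\<lambda>x v. reindex p (T' (reindex q x) (reindex q v))"
  have gV: "distr (gibbs ?V) borel (reindex q) = gibbs V"
    by (rule distr_gibbs_reindex[OF q V])
  \<comment> \<open>The relabelled measure is itself a pushforward of \<open>gibbs V\<close>, and so
    inherits total mass 1.\<close>
  have "gibbs ?V = distr (gibbs V) borel (reindex p)"
    using distr_gibbs_reindex[OF p, of ?V] by simp
  then have "prob_space (gibbs ?V)"
    by (simp add: prob_space.prob_space_distr[OF pV])
  then have "distr (gibbs ?V) borel ?T = gibbs ?W"
  proof (rule distr_gibbs_change_of_variables_wellorder)
    show "(?T has_derivative ?T' x) (at x)" for x
      using bounded_linear.has_derivative[OF bounded_linear_reindex]
        has_derivative_compose[OF bounded_linear_imp_has_derivative[OF bounded_linear_reindex] T']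
      by blast
    show "bij ?T"
      by (rule bij_betw_byWitness[where f'="\<lambda>y. reindex p (inv T (reindex q y))"])
        (use T in \<open>auto simp: bij_is_surj surj_f_inv_f bij_is_inj inv_f_f\<close>)
    show "det (matrix (?T' x)) \<noteq> 0" for x
      using J[of "reindex q x"] unfolding J_def q_def .
    show "?W (?T x) = ?V x + ln \<bar>det (matrix (?T' x))\<bar>" for x
      using W_eq[of "reindex q x"] unfolding J_def q_def[symmetric] by simp
  qed measurable
  moreover have "distr (gibbs ?W) borel (reindex q) = gibbs W"
    by (rule distr_gibbs_reindex[OF q W])
  ultimately have "gibbs W = distr (gibbs ?V) borel (reindex q \<circ> ?T)"
    by (simp add: distr_distr flip: \<open>distr (gibbs ?V) borel ?T = gibbs ?W\<close>)
  also have "reindex q \<circ> ?T = T \<circ> reindex q"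
    by auto
  also have "distr (gibbs ?V) borel (T \<circ> reindex q) = distr (distr (gibbs ?V) borel (reindex q)) borel T"
    by (simp add: distr_distr)
  finally show ?thesis by (simp add: gV)
qed

section \<open>Uniqueness of the first variation\<close>

text \<open>The set where \<open>f\<close> is nonzero is open and null, and a nonempty open set is
  never negligible.\<close>

lemma continuous_AE_eq_0:
  fixes f :: "'a::euclidean_space \<Rightarrow> real"
  assumes f: "continuous_on UNIV f" and ae: "AE x in lborel. f x = 0"
  shows "f x = 0"
proof -
  let ?U = "{x. f x \<noteq> 0}"
  have U: "open ?U"
    using f by (intro open_Collect_neq continuous_intros)
  have "?U \<in> null_sets lborel"
    using ae U by (subst AE_iff_null_sets) auto
  then have "negligible ?U"
    by (simp add: negligible_iff_null_sets null_sets_completionI)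
  then show ?thesis
    using open_not_negligible[OF U] by blast
qed

lemma integrable_mult_bump:
  fixes f \<eta> :: "'a::euclidean_space \<Rightarrow> real"
  assumes "continuous_on UNIV f" "continuous_on UNIV \<eta>" "\<And>x. x \<notin> cball 0 R \<Longrightarrow> \<eta> x = 0"
  shows "integrable lborel (\<lambda>x. f x * \<eta> x)"
proof -
  have "(\<lambda>x. f x * \<eta> x) = (\<lambda>x. indicator (cball 0 R) x * (f x * \<eta> x))"
    using assms(3) by (auto simp: indicator_def fun_eq_iff)
  moreover have "integrable lborel (\<lambda>x. indicator (cball 0 R) x * (f x * \<eta> x))"
    by (intro integrable_ball_cont continuous_on_subset[OF continuous_on_mult[OF assms(1,2)] subset_UNIV])
  ultimately show ?thesis by simp
qed

text \<open>Tests with \<open>\<eta> = \<psi> (g - c)\<close>, where \<open>\<psi>\<close> is a bump function and \<open>c\<close> the mean of \<open>g\<close> against \<open>\<psi>\<close>.\<close>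

lemma constant_if_orthogonal_to_mean_zero:
  fixes g :: "'a::euclidean_space \<Rightarrow> real"
  assumes g: "continuous_on UNIV g"
    and orth: "\<And>\<eta> R. \<lbrakk>continuous_on UNIV \<eta>; \<And>x. x \<notin> cball 0 R \<Longrightarrow> \<eta> x = 0; (\<integral>x. \<eta> x \<partial>lborel) = 0\<rbrakk>
      \<Longrightarrow> (\<integral>x. g x * \<eta> x \<partial>lborel) = 0"
  shows "g x = g 0"
proof -
  have *: "\<exists>c. \<forall>x\<in>ball 0 R. g x = c" if R: "R > 0" for R
  proof -
    define \<psi> where "\<psi> = (\<lambda>x::'a. max 0 (R - norm x))"
    have \<psi>: "continuous_on UNIV \<psi>" "\<psi> x \<ge> 0" "x \<notin> cball 0 R \<Longrightarrow> \<psi> x = 0" for x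
      by (auto simp: \<psi>_def intro!: continuous_intros)
    have pos: "0 < (\<integral>x. \<psi> x \<partial>lborel)"
    proof -
      have "(\<integral>x. \<psi> x \<partial>lborel) \<noteq> 0"
      proof
        assume "(\<integral>x. \<psi> x \<partial>lborel) = 0"
        then have "AE x in lborel. \<psi> x = 0"
          using integral_nonneg_eq_0_iff_AE[of lborel \<psi>] integrable_mult_bump[of "\<lambda>_. 1" \<psi> R] \<psi> by simp
        then have "\<psi> 0 = 0"
          by (rule continuous_AE_eq_0[OF \<psi>(1)])
        then show False
          using R by (simp add: \<psi>_def)
      qed
      then show ?thesis
        using \<psi>(2) by (simp add: less_le integral_nonneg)
    qed
    \<comment> \<open>Weighting the mean by \<open>\<psi>\<close> is what makes
      \<open>\<eta>\<close> below have total mass 0 and hence be an admissible test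
      function.\<close>
    define c where "c = (\<integral>x. g x * \<psi> x \<partial>lborel) / (\<integral>x. \<psi> x \<partial>lborel)"
    define \<eta> where "\<eta> = (\<lambda>x. (g x - c) * \<psi> x)"
    have \<eta>: "continuous_on UNIV \<eta>" "x \<notin> cball 0 R \<Longrightarrow> \<eta> x = 0" for x
      using \<psi> g by (auto simp: \<eta>_def intro!: continuous_intros)
    note i1 = integrable_mult_bump[OF g \<psi>(1,3)] integrable_mult_bump[OF continuous_on_const[of _ c] \<psi>(1,3)]
    note i2 = integrable_mult_bump[OF g \<eta>] integrable_mult_bump[OF continuous_on_const[of _ c] \<eta>]
    have "(\<integral>x. \<eta> x \<partial>lborel) = (\<integral>x. g x * \<psi> x \<partial>lborel) - c * (\<integral>x. \<psi> x \<partial>lborel)"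
      using i1 by (simp add: \<eta>_def left_diff_distrib)
    then have \<eta>0: "(\<integral>x. \<eta> x \<partial>lborel) = 0"
      using pos by (simp add: c_def)
    \<comment> \<open>Since \<open>(g - c)^2 * \<psi> = g * \<eta> - c * \<eta>\<close>,
      orthogonality and zero mass make this nonnegative integral vanish.\<close>
    have "(\<integral>x. (g x - c)\<^sup>2 * \<psi> x \<partial>lborel) = (\<integral>x. g x * \<eta> x - c * \<eta> x \<partial>lborel)"
      by (simp add: \<eta>_def power2_eq_square algebra_simps)
    also have "\<dots> = (\<integral>x. g x * \<eta> x \<partial>lborel) - c * (\<integral>x. \<eta> x \<partial>lborel)"
      using i2 by simp
    also have "\<dots> = 0"
      using orth[OF \<eta> \<eta>0] \<eta>0 by simp
    finally have "AE x in lborel. (g x - c)\<^sup>2 * \<psi> x = 0"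
      using \<psi> g by (subst integral_nonneg_eq_0_iff_AE[symmetric])
        (auto intro!: integrable_mult_bump[where R=R] continuous_intros)
    then have "(g x - c)\<^sup>2 * \<psi> x = 0" for x
      using \<psi> g by (intro continuous_AE_eq_0[of "\<lambda>x. (g x - c)\<^sup>2 * \<psi> x"] continuous_intros)
    moreover have "\<psi> x \<noteq> 0" if "x \<in> ball 0 R" for x
      using that by (simp add: \<psi>_def)
    ultimately have "\<forall>x\<in>ball 0 R. g x = c"
      by fastforce
    then show ?thesis ..
  qed
  \<comment> \<open>The constant depends on the radius, so a ball containing both \<open>x\<close>
    and 0 is chosen.\<close>
  obtain c where "\<forall>y\<in>ball 0 (norm x + 1). g y = c"
    using *[of "norm x + 1"] by (auto simp: add_nonneg_pos)
  then show ?thesis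
    by (simp add: add_nonneg_pos)
qed

text \<open>For each admissible \<open>\<eta>\<close> the integrals against \<open>f\<close> and
  \<open>g\<close> are derivatives at 0 of one and the same function of \<open>\<epsilon>\<close>.
  So \<open>f - g\<close> is orthogonal to all such tests and is constant.\<close>

lemma first_variation_unique:
  assumes f: "first_variation F p f" and g: "first_variation F p g"
  shows "f x = g x + (f 0 - g 0)"
proof -
  have cont: "continuous_on UNIV f" "continuous_on UNIV g"
    using f g by (auto simp: first_variation_def)
  have "(\<lambda>x. f x - g x) x = (\<lambda>x. f x - g x) 0"
  proof (rule constant_if_orthogonal_to_mean_zero)
    show "continuous_on UNIV (\<lambda>x. f x - g x)"
      using cont by (rule continuous_on_diff)
    fix \<eta> :: "'a \<Rightarrow> real" and R
    assume \<eta>: "continuous_on UNIV \<eta>" "\<And>x. x \<notin> cball 0 R \<Longrightarrow> \<eta> x = 0" "(\<integral>x. \<eta> x \<partial>lborel) = 0"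
    let ?G = "\<lambda>\<epsilon>. real_of_ereal (F (dens (\<lambda>x. indicator (cball 0 R) x * (p x + \<epsilon> * \<eta> x))))"
    have "(?G has_real_derivative (\<integral>x. f x * \<eta> x \<partial>lborel)) (at 0)"
      "(?G has_real_derivative (\<integral>x. g x * \<eta> x \<partial>lborel)) (at 0)"
      using f g \<eta> unfolding first_variation_def Let_def by blast+
    then have "(\<integral>x. f x * \<eta> x \<partial>lborel) = (\<integral>x. g x * \<eta> x \<partial>lborel)"
      by (rule DERIV_unique)
    then show "(\<integral>x. (f x - g x) * \<eta> x \<partial>lborel) = 0"
      using integrable_mult_bump[OF cont(1) \<eta>(1,2)] integrable_mult_bump[OF cont(2) \<eta>(1,2)]
      by (simp add: left_diff_distrib)
  qed
  then show ?thesis by simp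
qed

section \<open>Strongly monotone maps and gradient steps\<close>

lemma GDERIV_frechet:
  fixes f :: "'a::euclidean_space \<Rightarrow> real"
  assumes "(f has_derivative f') (at x)"
  shows "GDERIV f x :> (\<Sum>b\<in>Basis. f' b *\<^sub>R b)"
proof -
  interpret bounded_linear f'
    using assms by (rule has_derivative_bounded_linear)
  have eq: "f' h = h \<bullet> (\<Sum>b\<in>Basis. f' b *\<^sub>R b)" for h
    by (subst euclidean_representation[symmetric, of h])
      (simp add: sum scaleR inner_sum_right mult.commute)
  show ?thesis
    unfolding gderiv_def by (rule has_derivative_eq_rhs[OF assms ext[OF eq]])
qed

lemma GDERIV_imp_grad:
  fixes f :: "'a::euclidean_space \<Rightarrow> real"
  assumes "GDERIV f x :> D"
  shows "grad f x = D"
  unfolding grad_def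
proof (rule the_equality)
  fix D' assume "GDERIV f x :> D'"
  then have "(\<lambda>h. h \<bullet> D') = (\<lambda>h. h \<bullet> D)"
    using assms unfolding gderiv_def by (rule has_derivative_unique)
  then show "D' = D"
    by (metis inner_commute vector_eq_ldot)
qed (rule assms)

lemma GDERIV_grad:
  fixes f :: "'a::euclidean_space \<Rightarrow> real"
  assumes "f differentiable (at x)"
  shows "GDERIV f x :> grad f x"
  using assms GDERIV_frechet GDERIV_imp_grad unfolding differentiable_def by metis

lemma C_k_grad:
  fixes f :: "'a::euclidean_space \<Rightarrow> real"
  assumes "C_k (Suc k) f"
  shows "C_k k (grad f)"
proof -
  have "grad f = (\<lambda>x. \<Sum>b\<in>Basis. frechet_derivative f (at x) b *\<^sub>R b)"
    using GDERIV_imp_grad[OF GDERIV_frechet[OF C_k_SucD(1)[OF assms]]] by blast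
  then show ?thesis
    by (simp add: C_k_sum C_k_scaleR C_k_const C_k_SucD(2)[OF assms])
qed

text \<open>\<open>Hess\<close> is defined through \<open>jacobian\<close>, which represents the
  derivative only where \<open>grad f\<close> is differentiable. Two orders of differentiability of
  \<open>f\<close> ensure this.\<close>

lemma has_derivative_grad:
  fixes f :: "real^'n \<Rightarrow> real"
  assumes "C_k (Suc (Suc k)) f"
  shows "(grad f has_derivative (*v) (Hess f x)) (at x)"
  using C_k_grad[OF assms] jacobian_works unfolding Hess_def by auto

section \<open>Coercive maps: expansion and global inversion\<close>

lemma coercive_imp_expanding:
  fixes T :: "'a::real_inner \<Rightarrow> 'a"
  assumes T': "\<And>x. (T has_derivative T' x) (at x)"
    and coercive: "\<And>x v. c * (v \<bullet> v) \<le> v \<bullet> T' x v"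
  shows "c * dist x y \<le> dist (T x) (T y)"
proof (cases "x = y")
  case False
  let ?v = "x - y"
  \<comment> \<open>The mean value theorem is applied to this scalar function along the segment from
    \<open>y\<close> to \<open>x\<close>; Cauchy-Schwarz then turns the monotonicity estimate into
    expansion.\<close>
  let ?f = "\<lambda>t. ?v \<bullet> T (y + t *\<^sub>R ?v)"
  have "((\<lambda>t. T (y + t *\<^sub>R ?v)) has_derivative (\<lambda>h. T' (y + t *\<^sub>R ?v) (h *\<^sub>R ?v))) (at t)" for t
    by (rule has_derivative_compose[OF _ T']) (auto intro!: derivative_eq_intros)
  then have "(?f has_derivative (\<lambda>h. ?v \<bullet> T' (y + t *\<^sub>R ?v) (h *\<^sub>R ?v))) (at t)" for t
    by (rule has_derivative_inner_right)
  moreover have "?v \<bullet> T' z (h *\<^sub>R ?v) = (?v \<bullet> T' z ?v) * h" for z h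
    using has_derivative_bounded_linear[OF T'] by (simp add: linear_simps)
  ultimately have "DERIV ?f t :> ?v \<bullet> T' (y + t *\<^sub>R ?v) ?v" for t
    by (simp add: has_field_derivative_def)
  then obtain t where "?f 1 - ?f 0 = ?v \<bullet> T' (y + t *\<^sub>R ?v) ?v"
    using MVT2[of 0 1 ?f "\<lambda>t. ?v \<bullet> T' (y + t *\<^sub>R ?v) ?v"] by auto
  then have "c * (?v \<bullet> ?v) \<le> ?v \<bullet> (T x - T y)"
    using coercive[of ?v] by (simp add: inner_diff_right)
  also have "\<dots> \<le> norm ?v * norm (T x - T y)"
    by (rule norm_cauchy_schwarz)
  finally have "norm ?v * (c * norm ?v) \<le> norm ?v * norm (T x - T y)"
    by (simp add: dot_square_norm power2_eq_square algebra_simps)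
  then show ?thesis
    using False by (simp add: dist_norm)
qed simp

lemma expanding_imp_bij:
  fixes T :: "'a::euclidean_space \<Rightarrow> 'a"
  assumes T: "continuous_on UNIV T" and c: "0 < c"
    and expanding: "\<And>x y. c * dist x y \<le> dist (T x) (T y)"
  shows "bij T" and "continuous_on UNIV (inv T)"
proof -
  have inj: "inj T"
    using expanding c by (metis dist_eq_0_iff dist_le_zero_iff injI mult_le_0_iff not_le zero_le_dist)
  have "open (range T)"
    using T inj by (simp add: invariance_of_domain)
  moreover have "closed (range T)"
    unfolding closed_sequential_limits
  proof (intro allI impI)
    fix y l assume y: "(\<forall>n. y n \<in> range T) \<and> y \<longlonglongrightarrow> l"
    define x where "x = (\<lambda>n. inv T (y n))"
    have Tx: "(\<lambda>n. T (x n)) \<longlonglongrightarrow> l"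
      using y by (simp add: x_def f_inv_into_f)
    \<comment> \<open>Expansion bounds distances of preimages by \<open>1 / c\<close> times those of
      images, so Cauchy sequences in the range lift to Cauchy sequences.\<close>
    have "Cauchy x"
    proof (rule metric_CauchyI)
      fix e :: real assume "0 < e"
      then obtain N where "dist (T (x m)) (T (x n)) < c * e" if "m \<ge> N" "n \<ge> N" for m n
        using metric_CauchyD[OF LIMSEQ_imp_Cauchy[OF Tx], of "c * e"] c by auto
      then have "dist (x m) (x n) < e" if "m \<ge> N" "n \<ge> N" for m n
        using that expanding[of "x m" "x n"] c by (meson le_less_trans mult_less_cancel_left_pos)
      then show "\<exists>N. \<forall>m\<ge>N. \<forall>n\<ge>N. dist (x m) (x n) < e" by blast
    qed
    then obtain z where "x \<longlonglongrightarrow> z"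
      by (meson Cauchy_convergent convergentD)
    then have "(\<lambda>n. T (x n)) \<longlonglongrightarrow> T z"
      using T by (simp add: continuous_on_tendsto_compose)
    then show "l \<in> range T"
      using LIMSEQ_unique[OF Tx] by blast
  qed
  ultimately have "surj T"
    using clopen[of "range T"] by auto
  with inj show bij: "bij T"
    by (simp add: bij_def)
  have "(1 / c)-lipschitz_on UNIV (inv T)"
  proof (rule lipschitz_onI)
    show "dist (inv T x) (inv T y) \<le> 1 / c * dist x y" for x y
      using expanding[of "inv T x" "inv T y"] c bij
      by (simp add: bij_is_surj surj_f_inv_f field_simps)
  qed (use c in simp)
  then show "continuous_on UNIV (inv T)"
    by (rule lipschitz_on_continuous_on)
qed

section \<open>Regularity of the pushed-forward potential\<close>

lemma det_nonzero_if_positive: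
  fixes A :: "real^'n^'n"
  assumes "\<And>v. v \<noteq> 0 \<Longrightarrow> 0 < v \<bullet> (A *v v)"
  shows "det A \<noteq> 0"
proof -
  have "v = 0" if "A *v v = 0" for v
    using assms[of v] that by auto
  then show ?thesis
    by (simp add: invertible_det_nz[symmetric] invertible_left_inverse matrix_left_invertible_ker)
qed

text \<open>Relabelling is an isometry; this transfers positivity of the quadratic form to the
  relabelled Jacobian.\<close>

lemma inner_reindex:
  assumes "bij p"
  shows "reindex p x \<bullet> reindex p y = x \<bullet> y"
  using sum.reindex_bij_betw[OF assms, of "\<lambda>i. x $ i * y $ i"] by (simp add: inner_vec_def reindex_def)

text \<open>Entries of the Jacobian of a C^(k+1) map are C^k, so the term \<open>ln |det|\<close> of
  the new potential is available only at level \<open>k\<close>. The term coming from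
  \<open>V\<close> and the inverse map are needed at no higher level.\<close>

lemma pushforward_gibbs_C_k:
  fixes T :: "real^'n \<Rightarrow> real^'n"
  assumes V: "prob_space (gibbs V)" "C_k k V"
    and T: "C_k (Suc k) T"
    and T': "\<And>x. (T has_derivative (*v) (A x)) (at x)"
    and c: "0 < c" and coercive: "\<And>x v. c * (v \<bullet> v) \<le> v \<bullet> (A x *v v)"
  shows "\<exists>W. distr (gibbs V) borel T = gibbs W \<and> C_k k W"
proof -
  have pos: "0 < v \<bullet> (A x *v v)" if "v \<noteq> 0" for x v
    using coercive[of v x] c that by (meson inner_gt_zero_iff less_le_trans mult_pos_pos)
  note expanding = coercive_imp_expanding[OF T' coercive]
  have bij: "bij T" and inv: "continuous_on UNIV (inv T)"
    using expanding_imp_bij[OF C_k_continuous[OF T] c expanding] by blast+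
  define p where "p = (Rep_wellordered :: 'n wellordered \<Rightarrow> 'n)"
  define q where "q = inv p"
  define B where "B = (\<lambda>x. matrix (\<lambda>v. reindex p (A x *v reindex q v)))"
  \<comment> \<open>Solves \<open>W (T x) = V x + ln |det (B x)|\<close> for \<open>W\<close>
    through the global inverse of \<open>T\<close>.\<close>
  define W where "W = (\<lambda>y. V (inv T y) + ln \<bar>det (B (inv T y))\<bar>)"
  have p: "bij p"
    unfolding p_def by (rule bij_Rep_wellordered)
  have pq: "reindex p (reindex q v) = v" for v :: "real^'n wellordered"
    using p by (simp add: reindex_reindex q_def bij_is_inj inv_f_f)
  have "linear (\<lambda>v. reindex p (A x *v reindex q v))" for x
    using linear_compose[OF linear_compose[OF _ matrix_vector_mul_linear]
        bounded_linear.linear[OF bounded_linear_reindex]]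
      bounded_linear.linear[OF bounded_linear_reindex] by (fastforce simp: o_def)
  then have B: "B x *v v = reindex p (A x *v reindex q v)" for x v
    unfolding B_def by (simp add: matrix_works)
  have detB: "det (B x) \<noteq> 0" for x
  proof (rule det_nonzero_if_positive)
    fix v :: "real^'n wellordered" assume "v \<noteq> 0"
    then have "reindex q v \<noteq> 0"
      by (metis pq linear_0 bounded_linear.linear bounded_linear_reindex)
    then show "0 < v \<bullet> (B x *v v)"
      using pos inner_reindex[OF p, of "reindex q v"] by (simp add: B pq)
  qed
  have "C_k k (\<lambda>x. (A x *v v) $ i)" for v i
    by (rule C_k_linear_compose[OF bounded_linear_vec_nth C_k_derivative[OF T T']])
  then have CB: "C_k k (\<lambda>x. det (B x))"
    by (intro C_k_det) (simp add: B_def matrix_def reindex_def)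
  have Cinv: "C_k k (inv T)"
    using C_k_inverse_function[OF C_k_Suc_imp_C_k[OF T] T' det_nonzero_if_positive[OF pos] inv] bij
    by (simp add: bij_is_surj surj_f_inv_f)
  have "C_k k W"
    unfolding W_def by (intro C_k_add C_k_ln_abs C_k_compose[OF _ Cinv] V CB detB)
  moreover have "distr (gibbs V) borel T = gibbs W"
  proof (rule distr_gibbs_change_of_variables[OF V(1) _ _ T' bij])
    show "W (T x) = V x + ln \<bar>det (matrix (\<lambda>v. reindex Rep_wellordered (A x *v reindex (inv Rep_wellordered) v)))\<bar>" for x
      using bij by (simp add: W_def B_def p_def q_def bij_is_inj inv_f_f)
    show "det (matrix (\<lambda>v. reindex Rep_wellordered (A x *v reindex (inv Rep_wellordered) v))) \<noteq> 0" for x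
      using detB by (simp add: B_def p_def q_def)
  qed (use C_k_continuous V(2) \<open>C_k k W\<close> in \<open>blast intro: borel_measurable_continuous_onI\<close>)+
  ultimately show ?thesis by blast
qed

section \<open>The explicit Euler step\<close>

lemma mat_vector_mult: "(mat c :: real^'n^'n) *v v = c *\<^sub>R v"
  by (simp add: vec_eq_iff matrix_vector_mult_def mat_def if_distrib if_distribR cong: if_cong)

lemma loewner_leD: "loewner_le A B \<Longrightarrow> v \<bullet> (A *v v) \<le> v \<bullet> (B *v v)"
  by (auto simp: loewner_le_def positive_semidefinite_def matrix_vector_mult_diff_rdistrib inner_diff_right)

theorem proposition3p4:
  fixes U V0 \<phi> :: "real^'n \<Rightarrow> real"
    and F :: "(real^'n) measure \<Rightarrow> ereal"
    and T0 :: "real^'n \<Rightarrow> real^'n"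
    and m :: nat and M M0 h0 :: real
  assumes U_density: "prob_space (gibbs U)"
    and F_def: "F = (\<lambda>\<rho>. KL \<rho> (gibbs U))"
    and U_smooth: "C_infinity U"
    and M_pos: "0 < M"
    and U_gradient_lipschitz: "\<forall>x. loewner_le (Hess U x) (mat M)"
    and V0_density: "prob_space (gibbs V0)"
    and V0_regular: "C_k (m + 2) V0"
    and M0_pos: "0 < M0"
    and V0_hess: "\<forall>x. loewner_le (mat (- M0)) (Hess V0 x)"
    and phi: "first_variation F (\<lambda>x. exp (- V0 x)) \<phi>"
    and T0_def: "T0 = (\<lambda>x. x - h0 *\<^sub>R grad \<phi> x)"
    and h0: "h0 \<in> {0 <..< 1 / (M + M0)}"
  shows "\<exists>V1. distr (gibbs V0) borel T0 = gibbs V1 \<and> C_k m V1"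
proof -
  have U: "C_k (Suc (Suc m)) U" and V0: "C_k (Suc (Suc m)) V0"
    using U_smooth V0_regular by (simp_all add: C_infinity_def del: C_k.simps)
  \<comment> \<open>The bracket is the free additive constant, fixed by evaluating at 0; it
    disappears in the gradient.\<close>
  have \<phi>: "\<phi> = (\<lambda>x. 1 + U x - V0 x + (\<phi> 0 - (1 + U 0 - V0 0)))"
    using first_variation_unique[OF phi[unfolded F_def]
        first_variation_KL[OF C_k_continuous[OF U] C_k_continuous[OF V0] U_density]] by blast
  have grad_\<phi>: "grad \<phi> x = grad U x - grad V0 x" for x
  proof -
    have "GDERIV U x :> grad U x" "GDERIV V0 x :> grad V0 x"
      using U V0 by (auto intro: GDERIV_grad)
    then have "GDERIV (\<lambda>x. 1 + U x - V0 x + (\<phi> 0 - (1 + U 0 - V0 0))) x :> grad U x - grad V0 x"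
      unfolding gderiv_def by (auto intro!: derivative_eq_intros simp: inner_diff_right)
    then show ?thesis
      by (subst \<phi>) (rule GDERIV_imp_grad)
  qed
  define A where "A = (\<lambda>x. mat 1 - h0 *\<^sub>R (Hess U x - Hess V0 x))"
  \<comment> \<open>Differences are rewritten as sums with scalar factors so that the C^k closure
    rules apply.\<close>
  have T0: "T0 = (\<lambda>x. x + (- h0) *\<^sub>R (grad U x + (- 1) *\<^sub>R grad V0 x))"
    by (simp add: T0_def grad_\<phi>)
  have A: "A x *v v = v - h0 *\<^sub>R (Hess U x *v v - Hess V0 x *v v)" for x v
    by (simp add: A_def matrix_vector_mult_diff_rdistrib scaleR_matrix_vector_assoc[symmetric])
  show ?thesis
  proof (rule pushforward_gibbs_C_k[OF V0_density])
    show "C_k m V0"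
      using V0 by (rule C_k_mono) simp
    show "C_k (Suc m) T0"
      unfolding T0
      by (rule C_k_add[OF C_k_linear[OF bounded_linear_ident] C_k_scaleR[OF C_k_const
            C_k_add[OF C_k_grad[OF U] C_k_scaleR[OF C_k_const C_k_grad[OF V0]]]]])
    show "(T0 has_derivative (*v) (A x)) (at x)" for x
      unfolding T0 A
      by (auto intro!: derivative_eq_intros has_derivative_grad[OF U] has_derivative_grad[OF V0] simp: A fun_eq_iff)
    \<comment> \<open>This is where the step size restriction enters:
      \<open>h0 * (M + M0) < 1\<close> keeps the coercivity constant positive.\<close>
    show "0 < 1 - h0 * (M + M0)"
      using h0 M_pos M0_pos by (simp add: field_simps)
    show "(1 - h0 * (M + M0)) * (v \<bullet> v) \<le> v \<bullet> (A x *v v)" for x v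
    proof -
      \<comment> \<open>The upper bound on the Hessian of \<open>U\<close> and the lower bound on
        that of \<open>V0\<close> combine to bound the form of their difference by
        \<open>M + M0\<close>; multiplying by \<open>h0 > 0\<close> gives the claim.\<close>
      have "v \<bullet> (Hess U x *v v) \<le> M * (v \<bullet> v)" "- M0 * (v \<bullet> v) \<le> v \<bullet> (Hess V0 x *v v)"
        using loewner_leD[OF U_gradient_lipschitz[rule_format, of x], of v]
          loewner_leD[OF V0_hess[rule_format, of x], of v] by (simp_all add: mat_vector_mult)
      then have "h0 * (v \<bullet> (Hess U x *v v) - v \<bullet> (Hess V0 x *v v)) \<le> h0 * ((M + M0) * (v \<bullet> v))"
        using h0 by (intro mult_left_mono) (auto simp: algebra_simps)
      then show ?thesis
        by (simp add: A inner_diff_right algebra_simps)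
    qed
  qed
qed

end
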